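(* Work in $\mathsf{ZF}+\mathsf{WA}_0$. Let $\kappa_0=\kappa$ be the critical point of $j$ and $\kappa_{n+1}=j(\kappa_n)$. If the critical sequence $\langle\kappa_n\mid n\in\omega\rangle$ is cofinal in the ordinals, then $\kappa$ is extendible: for every ordinal $\eta$ there is an elementary embedding $k:V_{\kappa+\eta}\to V_\theta$ for some $\theta$, with critical point $\kappa$ and $\eta<k(\kappa)$ (namely $k=j^n\restriction V_{\kappa+\eta}$ for suitable $n$).
   Context: $\mathsf{WA}_0$ (Wholeness axiom for $\Delta_0$-formulas), in the language $\{\in,j\}$ with $j$ a unary function symbol: $j$ is elementary ($\phi(\vec x)\leftrightarrow\phi(j(\vec x))$ for every $\in$-formula $\phi$), $j$ is non-trivial, and Separation holds for $\Delta_0$-formulas of the extended language $\{\in,j\}$. The critical point of $j$ is the least ordinal $\kappa$ with $j(\kappa)\neq\kappa$. The critical sequence is cofinal if for every ordinal $\alpha$ there is $n$ with $\alpha<\kappa_n$. *)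

theory Defs
  imports Main
begin

text \<open>A model of set theory is represented by a carrier type 'a, a membership
relation E (E x y means x \<in> y) and an interpretation j of the unary
function symbol. Variables are natural numbers.\<close>

datatype trm = Var nat | J trm

datatype fm =
    Mem trm trm
  | Eq trm trm
  | Neg fm
  | Conj fm fm
  | Ex nat fm

fun trm_jfree :: "trm \<Rightarrow> bool" where
  "trm_jfree (Var n) = True"
| "trm_jfree (J t) = False"

fun fm_jfree :: "fm \<Rightarrow> bool" where
  "fm_jfree (Mem s t) = (trm_jfree s \<and> trm_jfree t)"
| "fm_jfree (Eq s t) = (trm_jfree s \<and> trm_jfree t)"
| "fm_jfree (Neg p) = fm_jfree p"
| "fm_jfree (Conj p q) = (fm_jfree p \<and> fm_jfree q)"
| "fm_jfree (Ex x p) = fm_jfree p"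

fun delta0 :: "fm \<Rightarrow> bool" where
  "delta0 (Mem s t) = True"
| "delta0 (Eq s t) = True"
| "delta0 (Neg p) = delta0 p"
| "delta0 (Conj p q) = (delta0 p \<and> delta0 q)"
| "delta0 (Ex x (Conj (Mem (Var x') (Var y)) p)) = (x' = x \<and> y \<noteq> x \<and> delta0 p)"
| "delta0 (Ex x p) = False"

fun evalt :: "('a \<Rightarrow> 'a) \<Rightarrow> (nat \<Rightarrow> 'a) \<Rightarrow> trm \<Rightarrow> 'a" where
  "evalt j s (Var n) = s n"
| "evalt j s (J t) = j (evalt j s t)"

fun satD :: "('a \<Rightarrow> 'a \<Rightarrow> bool) \<Rightarrow> ('a \<Rightarrow> 'a) \<Rightarrow> ('a \<Rightarrow> bool) \<Rightarrow> (nat \<Rightarrow> 'a) \<Rightarrow> fm \<Rightarrow> bool" where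
  "satD E j D s (Mem a b) = E (evalt j s a) (evalt j s b)"
| "satD E j D s (Eq a b) = (evalt j s a = evalt j s b)"
| "satD E j D s (Neg p) = (\<not> satD E j D s p)"
| "satD E j D s (Conj p q) = (satD E j D s p \<and> satD E j D s q)"
| "satD E j D s (Ex x p) = (\<exists>a. D a \<and> satD E j D (s(x := a)) p)"

definition sat :: "('a \<Rightarrow> 'a \<Rightarrow> bool) \<Rightarrow> ('a \<Rightarrow> 'a) \<Rightarrow> (nat \<Rightarrow> 'a) \<Rightarrow> fm \<Rightarrow> bool" where
  "sat E j s p = satD E j (\<lambda>_. True) s p"

definition ZF :: "('a \<Rightarrow> 'a \<Rightarrow> bool) \<Rightarrow> bool" where
  "ZF E \<longleftrightarrow>
     \<comment> \<open>Extensionality\<close>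
     (\<forall>x y. (\<forall>z. E z x \<longleftrightarrow> E z y) \<longrightarrow> x = y)
     \<comment> \<open>Foundation\<close>
   \<and> (\<forall>x. (\<exists>y. E y x) \<longrightarrow> (\<exists>y. E y x \<and> \<not> (\<exists>z. E z y \<and> E z x)))
     \<comment> \<open>Pairing\<close>
   \<and> (\<forall>x y. \<exists>p. \<forall>z. E z p \<longleftrightarrow> (z = x \<or> z = y))
     \<comment> \<open>Union\<close>
   \<and> (\<forall>x. \<exists>u. \<forall>z. E z u \<longleftrightarrow> (\<exists>y. E y x \<and> E z y))
     \<comment> \<open>Power set\<close>
   \<and> (\<forall>x. \<exists>p. \<forall>z. E z p \<longleftrightarrow> (\<forall>w. E w z \<longrightarrow> E w x))
     \<comment> \<open>Infinity\<close>
   \<and> (\<exists>I. (\<exists>e. E e I \<and> (\<forall>w. \<not> E w e)) \<and>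
          (\<forall>x. E x I \<longrightarrow> (\<exists>y. E y I \<and> (\<forall>w. E w y \<longleftrightarrow> (E w x \<or> w = x)))))
     \<comment> \<open>Separation scheme for \<in>-formulas (variable 0 is the separated variable,
         the other variables are parameters)\<close>
   \<and> (\<forall>p s a. fm_jfree p \<longrightarrow>
        (\<exists>b. \<forall>x. E x b \<longleftrightarrow> (E x a \<and> sat E id (s(0 := x)) p)))
     \<comment> \<open>Replacement scheme for \<in>-formulas (variables 0, 1 are x, y)\<close>
   \<and> (\<forall>p s a. fm_jfree p \<longrightarrow>
        (\<forall>x. E x a \<longrightarrow> (\<exists>!y. sat E id (s(0 := x, 1 := y)) p)) \<longrightarrow>
        (\<exists>b. \<forall>y. E y b \<longleftrightarrow> (\<exists>x. E x a \<and> sat E id (s(0 := x, 1 := y)) p)))"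

definition WA0 :: "('a \<Rightarrow> 'a \<Rightarrow> bool) \<Rightarrow> ('a \<Rightarrow> 'a) \<Rightarrow> bool" where
  "WA0 E j \<longleftrightarrow>
     (\<forall>p s. fm_jfree p \<longrightarrow> (sat E j s p \<longleftrightarrow> sat E j (j \<circ> s) p))
   \<and> (\<exists>x. j x \<noteq> x)
   \<and> (\<forall>p s a. delta0 p \<longrightarrow>
        (\<exists>b. \<forall>x. E x b \<longleftrightarrow> (E x a \<and> sat E j (s(0 := x)) p)))"

definition upair :: "('a \<Rightarrow> 'a \<Rightarrow> bool) \<Rightarrow> 'a \<Rightarrow> 'a \<Rightarrow> 'a \<Rightarrow> bool" where
  "upair E z x y \<longleftrightarrow> (\<forall>w. E w z \<longleftrightarrow> (w = x \<or> w = y))"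

definition kpair :: "('a \<Rightarrow> 'a \<Rightarrow> bool) \<Rightarrow> 'a \<Rightarrow> 'a \<Rightarrow> 'a \<Rightarrow> bool" where
  "kpair E p x y \<longleftrightarrow> (\<exists>a b. upair E a x x \<and> upair E b x y \<and> upair E p a b)"

definition is_function :: "('a \<Rightarrow> 'a \<Rightarrow> bool) \<Rightarrow> 'a \<Rightarrow> 'a \<Rightarrow> bool" where
  "is_function E f A \<longleftrightarrow>
     (\<forall>p. E p f \<longrightarrow> (\<exists>x y. kpair E p x y \<and> E x A))
   \<and> (\<forall>x. E x A \<longrightarrow> (\<exists>!y. \<exists>p. E p f \<and> kpair E p x y))"

definition app :: "('a \<Rightarrow> 'a \<Rightarrow> bool) \<Rightarrow> 'a \<Rightarrow> 'a \<Rightarrow> 'a" where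
  "app E f x = (THE y. \<exists>p. E p f \<and> kpair E p x y)"

definition fun_into :: "('a \<Rightarrow> 'a \<Rightarrow> bool) \<Rightarrow> 'a \<Rightarrow> 'a \<Rightarrow> 'a \<Rightarrow> bool" where
  "fun_into E f A B \<longleftrightarrow> is_function E f A \<and> (\<forall>x. E x A \<longrightarrow> E (app E f x) B)"

definition subset :: "('a \<Rightarrow> 'a \<Rightarrow> bool) \<Rightarrow> 'a \<Rightarrow> 'a \<Rightarrow> bool" where
  "subset E x y \<longleftrightarrow> (\<forall>z. E z x \<longrightarrow> E z y)"

definition transitive :: "('a \<Rightarrow> 'a \<Rightarrow> bool) \<Rightarrow> 'a \<Rightarrow> bool" where
  "transitive E x \<longleftrightarrow> (\<forall>y. E y x \<longrightarrow> subset E y x)"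

text \<open>von Neumann ordinals (in the presence of Foundation).\<close>
definition Ord :: "('a \<Rightarrow> 'a \<Rightarrow> bool) \<Rightarrow> 'a \<Rightarrow> bool" where
  "Ord E a \<longleftrightarrow> transitive E a \<and> (\<forall>x. E x a \<longrightarrow> transitive E x)"

definition is_succ :: "('a \<Rightarrow> 'a \<Rightarrow> bool) \<Rightarrow> 'a \<Rightarrow> 'a \<Rightarrow> bool" where
  "is_succ E s a \<longleftrightarrow> (\<forall>w. E w s \<longleftrightarrow> (E w a \<or> w = a))"

text \<open>v = V_\<alpha>, defined by internal recursion V_\<beta> = \<Union>_{\<gamma><\<beta>} P(V_\<gamma>).\<close>
definition is_V :: "('a \<Rightarrow> 'a \<Rightarrow> bool) \<Rightarrow> 'a \<Rightarrow> 'a \<Rightarrow> bool" where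
  "is_V E \<alpha> v \<longleftrightarrow> Ord E \<alpha> \<and>
     (\<exists>f s. is_succ E s \<alpha> \<and> is_function E f s \<and> v = app E f \<alpha> \<and>
        (\<forall>\<beta>. E \<beta> s \<longrightarrow>
           (\<forall>x. E x (app E f \<beta>) \<longleftrightarrow> (\<exists>\<gamma>. E \<gamma> \<beta> \<and> subset E x (app E f \<gamma>)))))"

definition Vset :: "('a \<Rightarrow> 'a \<Rightarrow> bool) \<Rightarrow> 'a \<Rightarrow> 'a" where
  "Vset E \<alpha> = (THE v. is_V E \<alpha> v)"

text \<open>c = a + b (ordinal addition), by internal recursion a + \<beta> = a \<union> {a + \<gamma> | \<gamma> < \<beta>}.\<close>
definition is_oadd :: "('a \<Rightarrow> 'a \<Rightarrow> bool) \<Rightarrow> 'a \<Rightarrow> 'a \<Rightarrow> 'a \<Rightarrow> bool" where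
  "is_oadd E a b c \<longleftrightarrow> Ord E a \<and> Ord E b \<and>
     (\<exists>f s. is_succ E s b \<and> is_function E f s \<and> c = app E f b \<and>
        (\<forall>\<beta>. E \<beta> s \<longrightarrow>
           (\<forall>x. E x (app E f \<beta>) \<longleftrightarrow> (E x a \<or> (\<exists>\<gamma>. E \<gamma> \<beta> \<and> x = app E f \<gamma>)))))"

definition oadd :: "('a \<Rightarrow> 'a \<Rightarrow> bool) \<Rightarrow> 'a \<Rightarrow> 'a \<Rightarrow> 'a" where
  "oadd E a b = (THE c. is_oadd E a b c)"

definition is_crit :: "('a \<Rightarrow> 'a \<Rightarrow> bool) \<Rightarrow> ('a \<Rightarrow> 'a) \<Rightarrow> 'a \<Rightarrow> bool" where
  "is_crit E j \<kappa> \<longleftrightarrow> Ord E \<kappa> \<and> j \<kappa> \<noteq> \<kappa> \<and> (\<forall>\<gamma>. E \<gamma> \<kappa> \<longrightarrow> j \<gamma> = \<gamma>)"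

definition elem_emb :: "('a \<Rightarrow> 'a \<Rightarrow> bool) \<Rightarrow> 'a \<Rightarrow> 'a \<Rightarrow> 'a \<Rightarrow> bool" where
  "elem_emb E k A B \<longleftrightarrow> fun_into E k A B \<and>
     (\<forall>p s. fm_jfree p \<longrightarrow> (\<forall>i. E (s i) A) \<longrightarrow>
        (satD E id (\<lambda>x. E x A) s p \<longleftrightarrow> satD E id (\<lambda>x. E x B) (\<lambda>i. app E k (s i)) p))"

definition crit_emb :: "('a \<Rightarrow> 'a \<Rightarrow> bool) \<Rightarrow> 'a \<Rightarrow> 'a \<Rightarrow> bool" where
  "crit_emb E k \<kappa> \<longleftrightarrow> Ord E \<kappa> \<and> app E k \<kappa> \<noteq> \<kappa> \<and> (\<forall>\<gamma>. E \<gamma> \<kappa> \<longrightarrow> app E k \<gamma> = \<gamma>)"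

definition extendible :: "('a \<Rightarrow> 'a \<Rightarrow> bool) \<Rightarrow> 'a \<Rightarrow> bool" where
  "extendible E \<kappa> \<longleftrightarrow>
     (\<forall>\<eta>. Ord E \<eta> \<and> (\<exists>x. E x \<eta>) \<longrightarrow>
        (\<exists>k \<theta>. Ord E \<theta> \<and> elem_emb E k (Vset E (oadd E \<kappa> \<eta>)) (Vset E \<theta>)
              \<and> crit_emb E k \<kappa> \<and> E \<eta> (app E k \<kappa>)))"

end

theory Submission
  imports Defs
begin

(* Given an ordinal \<eta> > 0, cofinality of the critical sequence gives n with \<eta> < \<kappa>\<^sub>n = j\<^sup>n(\<kappa>)
   and \<kappa>\<^sub>n \<noteq> \<kappa>. The restriction k of j\<^sup>n to V\<^bsub>\<kappa>+\<eta>\<^esub> is a set: its graph is Delta_0-definable in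
   {\<in>, j} and lies in P(P(A \<union> j\<^sup>n(A))) for A = V\<^bsub>\<kappa>+\<eta>\<^esub>, so Delta_0 Separation cuts it out.
   Elementarity of j\<^sup>n, applied to relativized formulas, makes k elementary from A into
   j\<^sup>n(A) = V\<^bsub>j\<^sup>n(\<kappa>+\<eta>)\<^esub>; k fixes the ordinals below \<kappa> and sends \<kappa> to \<kappa>\<^sub>n > \<eta>. *)

locale zf =
  fixes E :: "'a \<Rightarrow> 'a \<Rightarrow> bool"
  assumes ZF: "ZF E"
begin

lemmas ZF_axioms = ZF[unfolded ZF_def]

lemma extensionality: "(\<And>z. E z x \<longleftrightarrow> E z y) \<Longrightarrow> x = y"
  using ZF_axioms[THEN conjunct1] by blast

lemma foundation: "E y x \<Longrightarrow> \<exists>y. E y x \<and> (\<forall>z. E z y \<longrightarrow> \<not> E z x)"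
  using ZF_axioms[THEN conjunct2, THEN conjunct1] by blast

lemma pairing: "\<exists>p. \<forall>z. E z p \<longleftrightarrow> z = x \<or> z = y"
  using ZF_axioms[THEN conjunct2, THEN conjunct2, THEN conjunct1] by blast

lemma union: "\<exists>u. \<forall>z. E z u \<longleftrightarrow> (\<exists>y. E y x \<and> E z y)"
  using ZF_axioms[THEN conjunct2, THEN conjunct2, THEN conjunct2, THEN conjunct1] by blast

lemma power: "\<exists>p. \<forall>z. E z p \<longleftrightarrow> subset E z x"
  using ZF_axioms[THEN conjunct2, THEN conjunct2, THEN conjunct2, THEN conjunct2, THEN conjunct1]
  unfolding subset_def by blast

lemma separation: "fm_jfree p \<Longrightarrow> \<exists>b. \<forall>x. E x b \<longleftrightarrow> E x a \<and> sat E id (s(0 := x)) p"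
  using ZF_axioms[THEN conjunct2, THEN conjunct2, THEN conjunct2, THEN conjunct2, THEN conjunct2,
      THEN conjunct2, THEN conjunct1]
  by blast

lemma replacement:
  "fm_jfree p \<Longrightarrow> (\<forall>x. E x a \<longrightarrow> (\<exists>!y. sat E id (s(0 := x, 1 := y)) p)) \<Longrightarrow>
    \<exists>b. \<forall>y. E y b \<longleftrightarrow> (\<exists>x. E x a \<and> sat E id (s(0 := x, 1 := y)) p)"
  using ZF_axioms[THEN conjunct2, THEN conjunct2, THEN conjunct2, THEN conjunct2, THEN conjunct2,
      THEN conjunct2, THEN conjunct2]
  by blast

lemma mem_irrefl: "\<not> E x x"
proof
  assume "E x x"
  obtain p where p: "\<forall>z. E z p \<longleftrightarrow> z = x" using pairing by blast
  then obtain y where "E y p" "\<forall>z. E z y \<longrightarrow> \<not> E z p" using foundation by blast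
  with p \<open>E x x\<close> show False by auto
qed

lemma upair_ex: "\<exists>z. upair E z x y"
  using pairing unfolding upair_def by blast

lemma upair_unique: "upair E z x y \<Longrightarrow> upair E z' x y \<Longrightarrow> z = z'"
  unfolding upair_def by (rule extensionality) blast

lemma kpair_ex: "\<exists>p. kpair E p x y"
proof -
  obtain a b where "upair E a x x" "upair E b x y" using upair_ex by blast
  moreover obtain p where "upair E p a b" using upair_ex by blast
  ultimately show ?thesis unfolding kpair_def by blast
qed

lemma kpair_unique: "kpair E p x y \<Longrightarrow> kpair E p' x y \<Longrightarrow> p = p'"
  unfolding kpair_def by (metis upair_unique)

lemma kpair_inject:
  assumes "kpair E p x y" "kpair E p x' y'"
  shows "x = x' \<and> y = y'"
proof -
  obtain a b where ab: "upair E a x x" "upair E b x y" "upair E p a b"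
    using assms(1) unfolding kpair_def by blast
  obtain a' b' where ab': "upair E a' x' x'" "upair E b' x' y'" "upair E p a' b'"
    using assms(2) unfolding kpair_def by blast
  have a: "E w a \<longleftrightarrow> w = x" "E w a' \<longleftrightarrow> w = x'" for w
    using ab(1) ab'(1) unfolding upair_def by blast+
  have b: "E w b \<longleftrightarrow> w = x \<or> w = y" "E w b' \<longleftrightarrow> w = x' \<or> w = y'" for w
    using ab(2) ab'(2) unfolding upair_def by blast+
  have p: "E w p \<longleftrightarrow> w = a \<or> w = b" "E w p \<longleftrightarrow> w = a' \<or> w = b'" for w
    using ab(3) ab'(3) unfolding upair_def by blast+
  have "x = x'"
    using p[of a] a b by metis
  moreover have "y = y'"
    using p[of b] p[of b'] a b \<open>x = x'\<close> by metis
  ultimately show ?thesis ..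
qed

lemma binary_union: "\<exists>u. \<forall>z. E z u \<longleftrightarrow> E z x \<or> E z y"
proof -
  obtain q where q: "\<forall>z. E z q \<longleftrightarrow> z = x \<or> z = y" using pairing by blast
  obtain u where u: "\<forall>z. E z u \<longleftrightarrow> (\<exists>w. E w q \<and> E z w)" using union by blast
  have "E z u \<longleftrightarrow> E z x \<or> E z y" for z using q u by auto
  then show ?thesis by blast
qed

lemma succ_ex: "\<exists>s. is_succ E s a"
proof -
  obtain p where "\<forall>z. E z p \<longleftrightarrow> z = a" using pairing by blast
  moreover obtain u where "\<forall>z. E z u \<longleftrightarrow> E z a \<or> E z p" using binary_union by blast
  ultimately show ?thesis unfolding is_succ_def by auto
qed

lemma succ_unique: "is_succ E s a \<Longrightarrow> is_succ E s' a \<Longrightarrow> s = s'"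
  unfolding is_succ_def by (intro extensionality) simp

lemma succ_mem: "is_succ E s a \<Longrightarrow> E a s"
  unfolding is_succ_def by blast

lemma transitive_succ: "is_succ E s a \<Longrightarrow> transitive E a \<Longrightarrow> transitive E s"
  unfolding is_succ_def transitive_def subset_def by blast

lemma Ord_succ: "is_succ E s a \<Longrightarrow> Ord E a \<Longrightarrow> Ord E s"
  unfolding is_succ_def Ord_def transitive_def subset_def by blast

lemma Ord_mem: "Ord E a \<Longrightarrow> E x a \<Longrightarrow> Ord E x"
  unfolding Ord_def transitive_def subset_def by blast

end

definition "fOr p q = Neg (Conj (Neg p) (Neg q))"
definition "fImp p q = Neg (Conj p (Neg q))"
definition "fIff p q = Conj (fImp p q) (fImp q p)"
definition "fAll x p = Neg (Ex x (Neg p))"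
definition "fBex x y p = Ex x (Conj (Mem (Var x) (Var y)) p)"
definition "fBall x y p = Neg (fBex x y (Neg p))"
definition "fMem i k = Mem (Var i) (Var k)"
definition "fEq i k = Eq (Var i) (Var k)"

lemma sat_simps[simp]:
  "sat E j t (Mem a b) = E (evalt j t a) (evalt j t b)"
  "sat E j t (Eq a b) = (evalt j t a = evalt j t b)"
  "sat E j t (Neg p) = (\<not> sat E j t p)"
  "sat E j t (Conj p q) = (sat E j t p \<and> sat E j t q)"
  "sat E j t (Ex x p) = (\<exists>a. sat E j (t(x:=a)) p)"
  "sat E j t (fOr p q) = (sat E j t p \<or> sat E j t q)"
  "sat E j t (fImp p q) = (sat E j t p \<longrightarrow> sat E j t q)"
  "sat E j t (fIff p q) = (sat E j t p \<longleftrightarrow> sat E j t q)"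
  "sat E j t (fAll x p) = (\<forall>a. sat E j (t(x:=a)) p)"
  "sat E j t (fBex x y p) = (\<exists>a. E a ((t(x:=a)) y) \<and> sat E j (t(x:=a)) p)"
  "sat E j t (fBall x y p) = (\<forall>a. E a ((t(x:=a)) y) \<longrightarrow> sat E j (t(x:=a)) p)"
  "sat E j t (fMem i k) = E (t i) (t k)"
  "sat E j t (fEq i k) = (t i = t k)"
  by (auto simp: sat_def fOr_def fImp_def fIff_def fAll_def fBex_def fBall_def fMem_def fEq_def)

lemma fm_jfree_simps[simp]:
  "fm_jfree (fOr p q) = (fm_jfree p \<and> fm_jfree q)"
  "fm_jfree (fImp p q) = (fm_jfree p \<and> fm_jfree q)"
  "fm_jfree (fIff p q) = (fm_jfree p \<and> fm_jfree q)"
  "fm_jfree (fAll x p) = fm_jfree p"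
  "fm_jfree (fBex x y p) = fm_jfree p"
  "fm_jfree (fBall x y p) = fm_jfree p"
  "fm_jfree (fMem i k)"
  "fm_jfree (fEq i k)"
  by (auto simp: fOr_def fImp_def fIff_def fAll_def fBex_def fBall_def fMem_def fEq_def)

text \<open>In the following formula builders the last argument m is the first variable used for
bound variables; all free variables must lie below m.\<close>

definition "fUpair z x y m = fAll m (fIff (fMem m z) (fOr (fEq m x) (fEq m y)))"
definition "fKpair p x y m = Ex m (Ex (Suc m)
   (Conj (fUpair m x x (m+2)) (Conj (fUpair (Suc m) x y (m+2)) (fUpair p m (Suc m) (m+2)))))"
definition "fInApp x f b m =
   Ex m (Conj (Ex (Suc m) (Conj (fMem (Suc m) f) (fKpair (Suc m) b m (m+2)))) (fMem x m))"
definition "fSubset x y m = fBall m x (fMem m y)"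
definition "fTrans x m = fBall m x (fSubset m x (Suc m))"
definition "fOrd x m = Conj (fTrans x m) (fBall m x (fTrans m (Suc m)))"
definition "fSucc s a m = fAll m (fIff (fMem m s) (fOr (fMem m a) (fEq m a)))"
definition "fFunction f s m = Conj
   (fBall m f (Ex (Suc m) (Ex (m+2) (Conj (fKpair m (Suc m) (m+2) (m+3)) (fMem (Suc m) s)))))
   (fBall m s (Ex (Suc m) (Conj (Ex (m+2) (Conj (fMem (m+2) f) (fKpair (m+2) m (Suc m) (m+3))))
      (fAll (m+3) (fImp (Ex (m+2) (Conj (fMem (m+2) f) (fKpair (m+2) m (m+3) (m+4))))
        (fEq (m+3) (Suc m)))))))"

lemma fm_jfree_internal[simp]:
  "fm_jfree (fUpair z x y m)" "fm_jfree (fKpair p x y m)" "fm_jfree (fInApp x f b m)"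
  "fm_jfree (fSubset x y m)" "fm_jfree (fTrans x m)" "fm_jfree (fOrd x m)"
  "fm_jfree (fSucc s a m)" "fm_jfree (fFunction f s m)"
  by (simp_all add: fUpair_def fKpair_def fInApp_def fSubset_def fTrans_def fOrd_def fSucc_def
      fFunction_def)

text \<open>x \<in> f(b), stated without the definite description of app so that an \<in>-formula expresses it.\<close>
definition in_app :: "('a \<Rightarrow> 'a \<Rightarrow> bool) \<Rightarrow> 'a \<Rightarrow> 'a \<Rightarrow> 'a \<Rightarrow> bool" where
  "in_app E f b x \<longleftrightarrow> (\<exists>y. (\<exists>p. E p f \<and> kpair E p b y) \<and> E x y)"

lemma sat_fUpair[simp]:
  "z < m \<Longrightarrow> x < m \<Longrightarrow> y < m \<Longrightarrow> sat E j t (fUpair z x y m) = upair E (t z) (t x) (t y)"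
  by (simp add: fUpair_def upair_def)

lemma sat_fKpair[simp]:
  "p < m \<Longrightarrow> x < m \<Longrightarrow> y < m \<Longrightarrow> sat E j t (fKpair p x y m) = kpair E (t p) (t x) (t y)"
  by (simp add: fKpair_def kpair_def)

lemma sat_fInApp[simp]:
  "x < m \<Longrightarrow> f < m \<Longrightarrow> b < m \<Longrightarrow> sat E j t (fInApp x f b m) = in_app E (t f) (t b) (t x)"
  by (simp add: fInApp_def in_app_def)

lemma sat_fSubset[simp]: "x < m \<Longrightarrow> y < m \<Longrightarrow> sat E j t (fSubset x y m) = subset E (t x) (t y)"
  by (simp add: fSubset_def subset_def)

lemma sat_fTrans[simp]: "x < m \<Longrightarrow> sat E j t (fTrans x m) = transitive E (t x)"
  by (simp add: fTrans_def transitive_def)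

lemma sat_fOrd[simp]: "x < m \<Longrightarrow> sat E j t (fOrd x m) = Ord E (t x)"
  by (simp add: fOrd_def Ord_def)

lemma sat_fSucc[simp]: "s < m \<Longrightarrow> a < m \<Longrightarrow> sat E j t (fSucc s a m) = is_succ E (t s) (t a)"
  by (simp add: fSucc_def is_succ_def)

lemma sat_fFunction[simp]:
  assumes "f < m" "s < m"
  shows "sat E j t (fFunction f s m) = is_function E (t f) (t s)"
proof -
  have "sat E j t (fFunction f s m) \<longleftrightarrow>
     (\<forall>p. E p (t f) \<longrightarrow> (\<exists>x y. kpair E p x y \<and> E x (t s))) \<and>
     (\<forall>x. E x (t s) \<longrightarrow> (\<exists>y. (\<exists>p. E p (t f) \<and> kpair E p x y) \<and>
        (\<forall>y'. (\<exists>p. E p (t f) \<and> kpair E p x y') \<longrightarrow> y' = y)))"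
    using assms by (simp add: fFunction_def)
  then show ?thesis
    unfolding is_function_def Ex1_def .
qed

context zf
begin

definition defined_at :: "'a \<Rightarrow> 'a \<Rightarrow> bool" where
  "defined_at f b \<longleftrightarrow> (\<exists>!y. \<exists>p. E p f \<and> kpair E p b y)"

lemma app_eq:
  assumes "defined_at f b" "E p f" "kpair E p b y"
  shows "app E f b = y"
  using assms unfolding defined_at_def app_def by (rule_tac the1_equality) blast+

lemma app_ex: "defined_at f b \<Longrightarrow> \<exists>p. E p f \<and> kpair E p b (app E f b)"
  using app_eq unfolding defined_at_def by blast

lemma in_app_iff: "defined_at f b \<Longrightarrow> in_app E f b x \<longleftrightarrow> E x (app E f b)"
  unfolding in_app_def using app_ex app_eq by blast

lemma function_defined_at: "is_function E f s \<Longrightarrow> E b s \<Longrightarrow> defined_at f b"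
  unfolding is_function_def defined_at_def by blast

lemma app_bounded: "\<exists>U. \<forall>b. defined_at g b \<longrightarrow> E (app E g b) U"
proof -
  obtain U1 where U1: "\<forall>z. E z U1 \<longleftrightarrow> (\<exists>y. E y g \<and> E z y)" using union by blast
  obtain U where U: "\<forall>z. E z U \<longleftrightarrow> (\<exists>y. E y U1 \<and> E z y)" using union by blast
  have "E (app E g b) U" if gb: "defined_at g b" for b
  proof -
    obtain p where "E p g" "kpair E p b (app E g b)" using app_ex[OF gb] by blast
    then obtain c d where "upair E d b (app E g b)" "upair E p c d" unfolding kpair_def by blast
    then have "E d p" "E (app E g b) d" unfolding upair_def by blast+
    with \<open>E p g\<close> show ?thesis using U1 U by blast
  qed
  then show ?thesis by blast
qed

text \<open>The formula is needed to separate the counterexamples, to which Foundation is applied.\<close>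
lemma definable_eps_induct:
  assumes tr: "transitive E S" and jf: "fm_jfree p"
    and defn: "\<And>x. E x S \<Longrightarrow> sat E id (t(0:=x)) p \<longleftrightarrow> Q x"
    and step: "\<And>x. E x S \<Longrightarrow> (\<And>y. E y x \<Longrightarrow> Q y) \<Longrightarrow> Q x"
    and xS: "E x S"
  shows "Q x"
proof (rule ccontr)
  assume "\<not> Q x"
  obtain D where D: "\<forall>z. E z D \<longleftrightarrow> E z S \<and> sat E id (t(0:=z)) (Neg p)"
    using separation[where p="Neg p" and a=S and s=t] jf by auto
  have "E x D" using D defn[OF xS] \<open>\<not> Q x\<close> xS by simp
  then obtain m where m: "E m D" "\<forall>z. E z m \<longrightarrow> \<not> E z D" using foundation by blast
  have mS: "E m S" using m D by blast
  have "Q m"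
  proof (rule step[OF mS])
    fix y assume "E y m"
    then have "E y S" using tr mS unfolding transitive_def subset_def by blast
    moreover have "\<not> E y D" using m \<open>E y m\<close> by blast
    ultimately show "Q y" using D defn by auto
  qed
  then show False using m D defn[OF mS] by simp
qed

lemma function_extend:
  assumes g: "is_function E g \<alpha>" and s: "is_succ E s \<alpha>"
  shows "\<exists>f. is_function E f s \<and> (\<forall>\<delta>. E \<delta> \<alpha> \<longrightarrow> app E f \<delta> = app E g \<delta>) \<and> app E f \<alpha> = w"
proof -
  obtain q where q: "kpair E q \<alpha> w" using kpair_ex by blast
  obtain sq where "\<forall>z. E z sq \<longleftrightarrow> z = q" using pairing by blast
  moreover obtain f where "\<forall>z. E z f \<longleftrightarrow> E z g \<or> E z sq" using binary_union by blast
  ultimately have f: "E z f \<longleftrightarrow> E z g \<or> z = q" for z by blast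
  have sE: "E z s \<longleftrightarrow> E z \<alpha> \<or> z = \<alpha>" for z using s unfolding is_succ_def by blast
  have g_dom: "\<exists>\<delta> v. kpair E p \<delta> v \<and> E \<delta> \<alpha>" if "E p g" for p
    using g that unfolding is_function_def by blast
  have f_below: "(\<exists>p. E p f \<and> kpair E p \<delta> y) \<longleftrightarrow> y = app E g \<delta>" if \<delta>: "E \<delta> \<alpha>" for \<delta> y
    using app_ex[OF function_defined_at[OF g \<delta>]] app_eq[OF function_defined_at[OF g \<delta>]]
      f q kpair_inject mem_irrefl \<delta> by metis
  have f_top: "(\<exists>p. E p f \<and> kpair E p \<alpha> y) \<longleftrightarrow> y = w" for y
    using f q g_dom kpair_inject mem_irrefl by metis
  have "is_function E f s"
    unfolding is_function_def
  proof (intro conjI allI impI)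
    fix p assume "E p f"
    then show "\<exists>x y. kpair E p x y \<and> E x s" using f g_dom q sE by blast
  next
    fix x assume "E x s"
    then consider "E x \<alpha>" | "x = \<alpha>" using sE by blast
    then show "\<exists>!y. \<exists>p. E p f \<and> kpair E p x y" by cases (simp_all add: f_below f_top)
  qed
  moreover have "app E f \<delta> = app E g \<delta>" if "E \<delta> \<alpha>" for \<delta>
    using f_below[OF that] app_eq function_defined_at[OF \<open>is_function E f s\<close>] sE that by blast
  moreover have "app E f \<alpha> = w"
    using f_top app_eq function_defined_at[OF \<open>is_function E f s\<close>] sE by blast
  ultimately show ?thesis by blast
qed

end

text \<open>Transfinite recursion F(\<beta>) = {x. Phi \<beta> (F restricted to \<beta>) x} along the ordinals, for a
step relation Phi defined by the \<in>-formula ph with x, \<beta>, F and the parameter c in the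
variables 10, 11, 12 and 20.\<close>

locale zf_recursion = zf E for E :: "'a \<Rightarrow> 'a \<Rightarrow> bool" +
  fixes Phi :: "'a \<Rightarrow> ('a \<Rightarrow> 'a) \<Rightarrow> 'a \<Rightarrow> bool" and c :: 'a and ph :: fm
  assumes Phi_cong: "(\<And>\<gamma>. E \<gamma> \<beta> \<Longrightarrow> F \<gamma> = G \<gamma>) \<Longrightarrow> Phi \<beta> F x = Phi \<beta> G x"
    and ph_jfree: "fm_jfree ph"
    and sat_ph: "t 20 = c \<Longrightarrow> (\<And>\<gamma>. E \<gamma> (t 11) \<Longrightarrow> defined_at (t 12) \<gamma>) \<Longrightarrow>
      sat E id t ph = Phi (t 11) (app E (t 12)) (t 10)"
    and Phi_bounded: "(\<And>\<gamma>. E \<gamma> \<beta> \<Longrightarrow> defined_at g \<gamma>) \<Longrightarrow> \<exists>B. \<forall>x. Phi \<beta> (app E g) x \<longrightarrow> E x B"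
begin

definition rec_fun :: "'a \<Rightarrow> 'a \<Rightarrow> bool" where
  "rec_fun f s \<longleftrightarrow> is_function E f s \<and>
     (\<forall>\<beta>. E \<beta> s \<longrightarrow> (\<forall>x. E x (app E f \<beta>) \<longleftrightarrow> Phi \<beta> (app E f) x))"

definition "fRecFun = fBall 11 13 (fAll 10 (fIff (fInApp 10 12 11 30) ph))"
definition "fRecExists d = Ex 12 (Ex 13 (Conj (fSucc 13 d 30) (Conj (fFunction 12 13 30) fRecFun)))"
definition "fRecValue d v = Ex 12 (Ex 13 (Conj (fSucc 13 d 30) (Conj (fFunction 12 13 30)
   (Conj fRecFun (fAll 10 (fIff (fMem 10 v) (fInApp 10 12 d 30)))))))"

lemma fm_jfree_rec[simp]: "fm_jfree fRecFun" "fm_jfree (fRecExists d)" "fm_jfree (fRecValue d v)"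
  using ph_jfree by (simp_all add: fRecFun_def fRecExists_def fRecValue_def)

lemma sat_fRecFun:
  assumes "is_function E (t 12) (t 13)" "transitive E (t 13)" "t 20 = c"
  shows "sat E id t fRecFun \<longleftrightarrow> rec_fun (t 12) (t 13)"
proof -
  have "sat E id t fRecFun \<longleftrightarrow> (\<forall>\<beta>. E \<beta> (t 13) \<longrightarrow>
      (\<forall>x. in_app E (t 12) \<beta> x \<longleftrightarrow> sat E id (t(11:=\<beta>, 10:=x)) ph))"
    by (simp add: fRecFun_def)
  also have "\<dots> \<longleftrightarrow> (\<forall>\<beta>. E \<beta> (t 13) \<longrightarrow>
      (\<forall>x. E x (app E (t 12) \<beta>) \<longleftrightarrow> Phi \<beta> (app E (t 12)) x))"
  proof (rule iff_allI, rule imp_cong[OF refl])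
    fix \<beta> assume \<beta>: "E \<beta> (t 13)"
    have "defined_at (t 12) \<gamma>" if "E \<gamma> \<beta>" for \<gamma>
      using function_defined_at[OF assms(1)] assms(2) \<beta> that unfolding transitive_def subset_def
      by blast
    then have "sat E id (t(11:=\<beta>, 10:=x)) ph = Phi \<beta> (app E (t 12)) x" for x
      using sat_ph[of "t(11:=\<beta>, 10:=x)"] assms(3) by simp
    then show "(\<forall>x. in_app E (t 12) \<beta> x \<longleftrightarrow> sat E id (t(11:=\<beta>, 10:=x)) ph) \<longleftrightarrow>
        (\<forall>x. E x (app E (t 12) \<beta>) \<longleftrightarrow> Phi \<beta> (app E (t 12)) x)"
      using in_app_iff function_defined_at[OF assms(1) \<beta>] by simp
  qed
  finally show ?thesis using assms(1) unfolding rec_fun_def by simp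
qed

lemma sat_fRecExists:
  assumes "d < 10" "t 20 = c" "transitive E (t d)"
  shows "sat E id t (fRecExists d) \<longleftrightarrow> (\<exists>f s. is_succ E s (t d) \<and> rec_fun f s)"
proof -
  have "sat E id t (fRecExists d) \<longleftrightarrow> (\<exists>f s. is_succ E s (t d) \<and> is_function E f s \<and>
      sat E id (t(12:=f, 13:=s)) fRecFun)"
    using assms(1) by (simp add: fRecExists_def)
  also have "\<dots> \<longleftrightarrow> (\<exists>f s. is_succ E s (t d) \<and> rec_fun f s)"
  proof (intro iff_exI)
    fix f s
    show "(is_succ E s (t d) \<and> is_function E f s \<and> sat E id (t(12:=f, 13:=s)) fRecFun) \<longleftrightarrow>
      (is_succ E s (t d) \<and> rec_fun f s)"
      using sat_fRecFun[of "t(12:=f, 13:=s)"] transitive_succ assms(2,3)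
      by (auto simp: rec_fun_def)
  qed
  finally show ?thesis .
qed

lemma sat_fRecValue:
  assumes "d < 10" "v < 10" "t 20 = c" "transitive E (t d)"
  shows "sat E id t (fRecValue d v) \<longleftrightarrow>
    (\<exists>f s. is_succ E s (t d) \<and> rec_fun f s \<and> t v = app E f (t d))"
proof -
  have "sat E id t (fRecValue d v) \<longleftrightarrow> (\<exists>f s. is_succ E s (t d) \<and> is_function E f s \<and>
      sat E id (t(12:=f, 13:=s)) fRecFun \<and> (\<forall>x. E x (t v) \<longleftrightarrow> in_app E f (t d) x))"
    using assms(1,2) by (simp add: fRecValue_def)
  also have "\<dots> \<longleftrightarrow> (\<exists>f s. is_succ E s (t d) \<and> rec_fun f s \<and> t v = app E f (t d))"
  proof (intro iff_exI)
    fix f s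
    show "(is_succ E s (t d) \<and> is_function E f s \<and> sat E id (t(12:=f, 13:=s)) fRecFun \<and>
        (\<forall>x. E x (t v) \<longleftrightarrow> in_app E f (t d) x)) \<longleftrightarrow>
      (is_succ E s (t d) \<and> rec_fun f s \<and> t v = app E f (t d))"
    proof (cases "is_succ E s (t d) \<and> is_function E f s")
      case True
      then have "transitive E s" using transitive_succ assms(4) by blast
      have "defined_at f (t d)" using True function_defined_at succ_mem by blast
      then have "(\<forall>x. E x (t v) \<longleftrightarrow> in_app E f (t d) x) \<longleftrightarrow> t v = app E f (t d)"
        using in_app_iff extensionality by auto
      then show ?thesis
        using sat_fRecFun[of "t(12:=f, 13:=s)"] True \<open>transitive E s\<close> assms(3)
        by (simp add: rec_fun_def)
    qed (auto simp: rec_fun_def)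
  qed
  finally show ?thesis .
qed

lemma rec_fun_agree:
  assumes r: "rec_fun f s" "rec_fun f' s'" and tr: "transitive E s" "transitive E s'"
    and \<beta>: "E \<beta> s" "E \<beta> s'"
  shows "app E f \<beta> = app E f' \<beta>"
proof -
  define t where "t = (\<lambda>_::nat. c)(1:=s', 2:=f, 3:=f')"
  define p where "p = fImp (fMem 0 1) (fAll 4 (fIff (fInApp 4 2 0 30) (fInApp 4 3 0 30)))"
  have ff: "is_function E f s" "is_function E f' s'" using r unfolding rec_fun_def by auto
  have "E \<beta> s' \<longrightarrow> app E f \<beta> = app E f' \<beta>"
  proof (rule definable_eps_induct[where S=s and p=p and t=t
        and Q="\<lambda>\<beta>. E \<beta> s' \<longrightarrow> app E f \<beta> = app E f' \<beta>"])
    show "fm_jfree p" by (simp add: p_def)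
  next
    fix x assume x: "E x s"
    show "sat E id (t(0:=x)) p \<longleftrightarrow> (E x s' \<longrightarrow> app E f x = app E f' x)"
    proof (cases "E x s'")
      case True
      then have "defined_at f x" "defined_at f' x" using function_defined_at ff x by blast+
      then show ?thesis using True in_app_iff extensionality by (auto simp: p_def t_def)
    qed (simp add: p_def t_def)
  next
    fix x assume x: "E x s" and IH: "\<And>y. E y x \<Longrightarrow> E y s' \<longrightarrow> app E f y = app E f' y"
    show "E x s' \<longrightarrow> app E f x = app E f' x"
    proof
      assume x': "E x s'"
      have "app E f y = app E f' y" if "E y x" for y
        using IH that tr(2) x' unfolding transitive_def subset_def by blast
      then have "Phi x (app E f) z \<longleftrightarrow> Phi x (app E f') z" for z
        by (rule Phi_cong)
      then show "app E f x = app E f' x"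
        using r x x' unfolding rec_fun_def by (intro extensionality) blast
    qed
  qed (use tr \<beta> in auto)
  then show ?thesis using \<beta> by blast
qed

lemma rec_fun_value_unique:
  assumes "transitive E \<alpha>" "is_succ E s \<alpha>" "rec_fun f s" "is_succ E s' \<alpha>" "rec_fun f' s'"
  shows "app E f \<alpha> = app E f' \<alpha>"
  using rec_fun_agree[of f s f' s'] assms succ_unique transitive_succ succ_mem by metis

end

context zf_recursion
begin

lemma rec_fun_glue:
  assumes \<alpha>: "Ord E \<alpha>" and IH: "\<And>\<gamma>. E \<gamma> \<alpha> \<Longrightarrow> \<exists>f s. is_succ E s \<gamma> \<and> rec_fun f s"
  shows "\<exists>g. is_function E g \<alpha> \<and>
    (\<forall>\<delta> f s. E \<delta> \<alpha> \<longrightarrow> is_succ E s \<delta> \<longrightarrow> rec_fun f s \<longrightarrow> app E g \<delta> = app E f \<delta>)"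
proof -
  have tr: "transitive E \<delta>" if "E \<delta> \<alpha>" for \<delta> using \<alpha> that unfolding Ord_def by blast
  define R where "R \<delta> y \<longleftrightarrow>
    (\<exists>v. kpair E y \<delta> v \<and> (\<exists>f s. is_succ E s \<delta> \<and> rec_fun f s \<and> v = app E f \<delta>))" for \<delta> y
  define pR where "pR = Ex 2 (Conj (fKpair 1 0 2 30) (fRecValue 0 2))"
  define t where "t = (\<lambda>_::nat. c)"
  have sat_pR: "sat E id (t(0:=\<delta>, 1:=y)) pR \<longleftrightarrow> R \<delta> y" if "E \<delta> \<alpha>" for \<delta> y
  proof -
    have "sat E id (t(0:=\<delta>, 1:=y)) pR \<longleftrightarrow>
        (\<exists>v. kpair E y \<delta> v \<and> sat E id (t(0:=\<delta>, 1:=y, 2:=v)) (fRecValue 0 2))"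
      by (simp add: pR_def)
    then show ?thesis
      unfolding R_def using sat_fRecValue[of 0 2 "t(0:=\<delta>, 1:=y, 2:=_)"] tr[OF that]
      by (simp add: t_def)
  qed
  have value_unique: "app E f \<delta> = app E f' \<delta>"
    if "E \<delta> \<alpha>" "is_succ E s \<delta>" "rec_fun f s" "is_succ E s' \<delta>" "rec_fun f' s'" for \<delta> f s f' s'
    using rec_fun_value_unique tr that by blast
  have R_unique: "\<exists>!y. R \<delta> y" if \<delta>: "E \<delta> \<alpha>" for \<delta>
  proof -
    obtain f s where fs: "is_succ E s \<delta>" "rec_fun f s" using IH \<delta> by blast
    obtain y where y: "kpair E y \<delta> (app E f \<delta>)" using kpair_ex by blast
    have "y' = y" if y': "R \<delta> y'" for y'
    proof -
      obtain f' s' where "kpair E y' \<delta> (app E f' \<delta>)" "is_succ E s' \<delta>" "rec_fun f' s'"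
        using y' unfolding R_def by blast
      then show ?thesis using value_unique[OF \<delta> fs] kpair_unique y by metis
    qed
    moreover have "R \<delta> y" unfolding R_def using fs y by blast
    ultimately show ?thesis by blast
  qed
  have "\<exists>g. \<forall>y. E y g \<longleftrightarrow> (\<exists>\<delta>. E \<delta> \<alpha> \<and> sat E id (t(0:=\<delta>, 1:=y)) pR)"
  proof (rule replacement)
    show "fm_jfree pR" by (simp add: pR_def)
    show "\<forall>\<delta>. E \<delta> \<alpha> \<longrightarrow> (\<exists>!y. sat E id (t(0:=\<delta>, 1:=y)) pR)" using R_unique sat_pR by simp
  qed
  then obtain g where g0: "\<forall>y. E y g \<longleftrightarrow> (\<exists>\<delta>. E \<delta> \<alpha> \<and> sat E id (t(0:=\<delta>, 1:=y)) pR)"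
    by blast
  have g: "E y g \<longleftrightarrow> (\<exists>\<delta>. E \<delta> \<alpha> \<and> R \<delta> y)" for y
    using g0 sat_pR by blast
  have g_val: "(\<exists>p. E p g \<and> kpair E p \<delta> y) \<longleftrightarrow> y = app E f \<delta>"
    if \<delta>: "E \<delta> \<alpha>" and fs: "is_succ E s \<delta>" "rec_fun f s" for \<delta> f s y
  proof
    assume "\<exists>p. E p g \<and> kpair E p \<delta> y"
    then obtain p \<delta>' f' s' where p: "kpair E p \<delta> y" "kpair E p \<delta>' (app E f' \<delta>')"
        and fs': "E \<delta>' \<alpha>" "is_succ E s' \<delta>'" "rec_fun f' s'"
      using g unfolding R_def by blast
    then have "\<delta>' = \<delta>" "y = app E f' \<delta>'" using kpair_inject by metis+
    then show "y = app E f \<delta>" using value_unique[OF \<delta> fs] fs' by simp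
  next
    assume "y = app E f \<delta>"
    moreover obtain p where "kpair E p \<delta> (app E f \<delta>)" using kpair_ex by blast
    ultimately show "\<exists>p. E p g \<and> kpair E p \<delta> y" using g \<delta> fs unfolding R_def by blast
  qed
  have "is_function E g \<alpha>"
    unfolding is_function_def
  proof (intro conjI allI impI)
    fix p assume "E p g"
    then show "\<exists>x y. kpair E p x y \<and> E x \<alpha>" using g unfolding R_def by blast
  next
    fix \<delta> assume \<delta>: "E \<delta> \<alpha>"
    then obtain f s where "is_succ E s \<delta>" "rec_fun f s" using IH by blast
    then show "\<exists>!y. \<exists>p. E p g \<and> kpair E p \<delta> y" using g_val[OF \<delta>] by simp
  qed
  moreover have "app E g \<delta> = app E f \<delta>" if "E \<delta> \<alpha>" "is_succ E s \<delta>" "rec_fun f s" for \<delta> f s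
    using g_val[OF that] app_eq function_defined_at[OF \<open>is_function E g \<alpha>\<close> \<open>E \<delta> \<alpha>\<close>] by blast
  ultimately show ?thesis by blast
qed

lemma Phi_set:
  assumes "\<And>\<gamma>. E \<gamma> \<beta> \<Longrightarrow> defined_at g \<gamma>"
  shows "\<exists>w. \<forall>x. E x w \<longleftrightarrow> Phi \<beta> (app E g) x"
proof -
  obtain B where B: "\<forall>x. Phi \<beta> (app E g) x \<longrightarrow> E x B" using Phi_bounded assms by blast
  define p where "p = Ex 10 (Conj (fEq 10 0) ph)"
  define t where "t = (\<lambda>_::nat. c)(11:=\<beta>, 12:=g)"
  have "sat E id (t(0:=x)) p \<longleftrightarrow> Phi \<beta> (app E g) x" for x
  proof -
    have "sat E id (t(0:=x)) p \<longleftrightarrow> sat E id (t(0:=x, 10:=x)) ph" by (auto simp: p_def)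
    then show ?thesis using sat_ph[of "t(0:=x, 10:=x)"] assms by (simp add: t_def)
  qed
  moreover obtain w where "\<forall>x. E x w \<longleftrightarrow> E x B \<and> sat E id (t(0:=x)) p"
    using separation[of p B t] ph_jfree by (auto simp: p_def)
  ultimately show ?thesis using B by blast
qed

lemma rec_fun_succ:
  assumes \<alpha>: "Ord E \<alpha>" and IH: "\<And>\<gamma>. E \<gamma> \<alpha> \<Longrightarrow> \<exists>f s. is_succ E s \<gamma> \<and> rec_fun f s"
  shows "\<exists>f s. is_succ E s \<alpha> \<and> rec_fun f s"
proof -
  obtain g where g: "is_function E g \<alpha>"
    and g_val: "\<And>\<delta> f s. E \<delta> \<alpha> \<Longrightarrow> is_succ E s \<delta> \<Longrightarrow> rec_fun f s \<Longrightarrow> app E g \<delta> = app E f \<delta>"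
    using rec_fun_glue[OF assms] by blast
  obtain w where w: "\<forall>x. E x w \<longleftrightarrow> Phi \<alpha> (app E g) x"
    using Phi_set function_defined_at[OF g] by blast
  obtain s where s: "is_succ E s \<alpha>" using succ_ex by blast
  obtain f where f: "is_function E f s" "\<And>\<delta>. E \<delta> \<alpha> \<Longrightarrow> app E f \<delta> = app E g \<delta>" "app E f \<alpha> = w"
    using function_extend[OF g s] by blast
  have "rec_fun f s"
    unfolding rec_fun_def
  proof (intro conjI allI impI f(1))
    fix \<beta> x assume "E \<beta> s"
    then consider "E \<beta> \<alpha>" | "\<beta> = \<alpha>" using s unfolding is_succ_def by blast
    then show "E x (app E f \<beta>) \<longleftrightarrow> Phi \<beta> (app E f) x"
    proof cases
      case 1
      obtain f' s' where fs': "is_succ E s' \<beta>" "rec_fun f' s'" using IH 1 by blast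
      have "app E f' \<gamma> = app E f \<gamma>" if "E \<gamma> \<beta>" for \<gamma>
      proof -
        have \<gamma>: "E \<gamma> \<alpha>" using \<alpha> 1 that unfolding Ord_def transitive_def subset_def by blast
        obtain f'' s'' where fs'': "is_succ E s'' \<gamma>" "rec_fun f'' s''" using IH \<gamma> by blast
        have "transitive E \<beta>" "transitive E \<gamma>" using \<alpha> 1 \<gamma> unfolding Ord_def by blast+
        then have "transitive E s'" "transitive E s''" using fs'(1) fs''(1) transitive_succ by blast+
        moreover have "E \<gamma> s'" "E \<gamma> s''" using fs'(1) fs''(1) that succ_mem
          unfolding is_succ_def by blast+
        ultimately have "app E f' \<gamma> = app E f'' \<gamma>"
          using rec_fun_agree[OF fs'(2) fs''(2)] by blast
        then show ?thesis using g_val[OF \<gamma> fs''] f(2)[OF \<gamma>] by simp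
      qed
      then have "Phi \<beta> (app E f') x \<longleftrightarrow> Phi \<beta> (app E f) x" by (rule Phi_cong)
      moreover have "E x (app E f' \<beta>) \<longleftrightarrow> Phi \<beta> (app E f') x"
        using fs' succ_mem unfolding rec_fun_def by blast
      ultimately show ?thesis using f(2)[OF 1] g_val[OF 1 fs'] by simp
    next
      case 2
      have "Phi \<alpha> (app E g) x \<longleftrightarrow> Phi \<alpha> (app E f) x" by (rule Phi_cong) (simp add: f(2))
      then show ?thesis using 2 w f(3) by simp
    qed
  qed
  with s show ?thesis by blast
qed

lemma rec_fun_exists:
  assumes "Ord E \<alpha>"
  shows "\<exists>f s. is_succ E s \<alpha> \<and> rec_fun f s"
proof -
  obtain S where S: "is_succ E S \<alpha>" using succ_ex by blast
  define t where "t = (\<lambda>_::nat. c)"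
  define p where "p = fImp (fOrd 0 30) (fRecExists 0)"
  have "Ord E \<alpha> \<longrightarrow> (\<exists>f s. is_succ E s \<alpha> \<and> rec_fun f s)"
  proof (rule definable_eps_induct[where S=S and p=p and t=t
        and Q="\<lambda>\<delta>. Ord E \<delta> \<longrightarrow> (\<exists>f s. is_succ E s \<delta> \<and> rec_fun f s)"])
    show "transitive E S" using transitive_succ S assms unfolding Ord_def by blast
    show "fm_jfree p" by (simp add: p_def)
    show "E \<alpha> S" using succ_mem S by blast
  next
    fix x
    show "sat E id (t(0:=x)) p \<longleftrightarrow> (Ord E x \<longrightarrow> (\<exists>f s. is_succ E s x \<and> rec_fun f s))"
    proof (cases "Ord E x")
      case True
      then have "transitive E x" unfolding Ord_def by blast
      then show ?thesis using sat_fRecExists[of 0 "t(0:=x)"] True by (simp add: p_def t_def)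
    qed (simp add: p_def)
  next
    fix x assume "\<And>y. E y x \<Longrightarrow> Ord E y \<longrightarrow> (\<exists>f s. is_succ E s y \<and> rec_fun f s)"
    then show "Ord E x \<longrightarrow> (\<exists>f s. is_succ E s x \<and> rec_fun f s)"
      using rec_fun_succ Ord_mem by metis
  qed
  then show ?thesis using assms by blast
qed

lemma rec_value_ex1: "Ord E \<alpha> \<Longrightarrow> \<exists>!v. \<exists>f s. is_succ E s \<alpha> \<and> rec_fun f s \<and> v = app E f \<alpha>"
  using rec_fun_exists rec_fun_value_unique unfolding Ord_def by metis

end

definition V_step :: "('a \<Rightarrow> 'a \<Rightarrow> bool) \<Rightarrow> 'a \<Rightarrow> ('a \<Rightarrow> 'a) \<Rightarrow> 'a \<Rightarrow> bool" where
  "V_step E \<beta> F x \<longleftrightarrow> (\<exists>\<gamma>. E \<gamma> \<beta> \<and> subset E x (F \<gamma>))"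

definition "fV_step =
  fBex 31 11 (Ex 32 (Conj (Ex 33 (Conj (fMem 33 12) (fKpair 33 31 32 40))) (fSubset 10 32 40)))"

definition oadd_step :: "('a \<Rightarrow> 'a \<Rightarrow> bool) \<Rightarrow> 'a \<Rightarrow> 'a \<Rightarrow> ('a \<Rightarrow> 'a) \<Rightarrow> 'a \<Rightarrow> bool" where
  "oadd_step E a \<beta> F x \<longleftrightarrow> E x a \<or> (\<exists>\<gamma>. E \<gamma> \<beta> \<and> x = F \<gamma>)"

definition "fOadd_step = fOr (fMem 10 20) (fBex 31 11 (Ex 33 (Conj (fMem 33 12) (fKpair 33 31 10 40))))"

context zf
begin

lemma zf_recursion_V: "zf_recursion E (V_step E) c fV_step"
proof (unfold_locales)
  fix \<beta> x and F G :: "'a \<Rightarrow> 'a" assume "\<And>\<gamma>. E \<gamma> \<beta> \<Longrightarrow> F \<gamma> = G \<gamma>"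
  then show "V_step E \<beta> F x = V_step E \<beta> G x" unfolding V_step_def by auto
next
  show "fm_jfree fV_step" by (simp add: fV_step_def)
next
  fix t :: "nat \<Rightarrow> 'a" assume "\<And>\<gamma>. E \<gamma> (t 11) \<Longrightarrow> defined_at (t 12) \<gamma>"
  then have "(\<exists>y. (\<exists>p. E p (t 12) \<and> kpair E p \<gamma> y) \<and> subset E (t 10) y) \<longleftrightarrow>
      subset E (t 10) (app E (t 12) \<gamma>)" if "E \<gamma> (t 11)" for \<gamma>
    using that app_ex app_eq by metis
  then show "sat E id t fV_step = V_step E (t 11) (app E (t 12)) (t 10)"
    unfolding V_step_def by (auto simp: fV_step_def)
next
  fix \<beta> g assume g: "\<And>\<gamma>. E \<gamma> \<beta> \<Longrightarrow> defined_at g \<gamma>"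
  obtain U where U: "\<forall>\<gamma>. defined_at g \<gamma> \<longrightarrow> E (app E g \<gamma>) U" using app_bounded by blast
  obtain V where V: "\<forall>z. E z V \<longleftrightarrow> (\<exists>y. E y U \<and> E z y)" using union by blast
  obtain B where B: "\<forall>z. E z B \<longleftrightarrow> subset E z V" using power by blast
  have "E x B" if "V_step E \<beta> (app E g) x" for x
    using that g U V B unfolding V_step_def subset_def by blast
  then show "\<exists>B. \<forall>x. V_step E \<beta> (app E g) x \<longrightarrow> E x B" by blast
qed

lemma zf_recursion_oadd: "zf_recursion E (oadd_step E a) a fOadd_step"
proof (unfold_locales)
  fix \<beta> x and F G :: "'a \<Rightarrow> 'a" assume "\<And>\<gamma>. E \<gamma> \<beta> \<Longrightarrow> F \<gamma> = G \<gamma>"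
  then show "oadd_step E a \<beta> F x = oadd_step E a \<beta> G x" unfolding oadd_step_def by auto
next
  show "fm_jfree fOadd_step" by (simp add: fOadd_step_def)
next
  fix t :: "nat \<Rightarrow> 'a" assume "t 20 = a" and "\<And>\<gamma>. E \<gamma> (t 11) \<Longrightarrow> defined_at (t 12) \<gamma>"
  moreover have "(\<exists>p. E p (t 12) \<and> kpair E p \<gamma> (t 10)) \<longleftrightarrow> t 10 = app E (t 12) \<gamma>"
    if "defined_at (t 12) \<gamma>" for \<gamma>
    using that app_ex app_eq by metis
  ultimately show "sat E id t fOadd_step = oadd_step E a (t 11) (app E (t 12)) (t 10)"
    unfolding oadd_step_def by (auto simp: fOadd_step_def)
next
  fix \<beta> g assume g: "\<And>\<gamma>. E \<gamma> \<beta> \<Longrightarrow> defined_at g \<gamma>"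
  obtain U where U: "\<forall>\<gamma>. defined_at g \<gamma> \<longrightarrow> E (app E g \<gamma>) U" using app_bounded by blast
  obtain B where B: "\<forall>z. E z B \<longleftrightarrow> E z a \<or> E z U" using binary_union by blast
  have "E x B" if "oadd_step E a \<beta> (app E g) x" for x
    using that g U B unfolding oadd_step_def by blast
  then show "\<exists>B. \<forall>x. oadd_step E a \<beta> (app E g) x \<longrightarrow> E x B" by blast
qed

lemma is_V_iff_rec_fun:
  "is_V E \<alpha> v \<longleftrightarrow> Ord E \<alpha> \<and>
    (\<exists>f s. is_succ E s \<alpha> \<and> zf_recursion.rec_fun E (V_step E) f s \<and> v = app E f \<alpha>)"
  unfolding is_V_def zf_recursion.rec_fun_def[OF zf_recursion_V] V_step_def by blast

lemma is_oadd_iff_rec_fun: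
  "is_oadd E a b c \<longleftrightarrow> Ord E a \<and> Ord E b \<and>
    (\<exists>f s. is_succ E s b \<and> zf_recursion.rec_fun E (oadd_step E a) f s \<and> c = app E f b)"
  unfolding is_oadd_def zf_recursion.rec_fun_def[OF zf_recursion_oadd] oadd_step_def by blast

lemma is_V_Vset: "Ord E \<alpha> \<Longrightarrow> is_V E \<alpha> (Vset E \<alpha>)"
  unfolding Vset_def
  using zf_recursion.rec_value_ex1[OF zf_recursion_V] is_V_iff_rec_fun theI' by metis

lemma Vset_eqI: "is_V E \<alpha> v \<Longrightarrow> Vset E \<alpha> = v"
  unfolding Vset_def
  using zf_recursion.rec_value_ex1[OF zf_recursion_V] is_V_iff_rec_fun the1_equality by metis

lemma is_oadd_oadd: "Ord E a \<Longrightarrow> Ord E b \<Longrightarrow> is_oadd E a b (oadd E a b)"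
  unfolding oadd_def
  using zf_recursion.rec_value_ex1[OF zf_recursion_oadd] is_oadd_iff_rec_fun theI' by metis

lemma mem_Vset:
  assumes \<alpha>: "Ord E \<alpha>" and \<delta>: "E \<delta> \<alpha>"
  shows "E \<delta> (Vset E \<alpha>)"
proof -
  interpret V: zf_recursion E "V_step E" undefined fV_step by (rule zf_recursion_V)
  obtain f s where fs: "is_succ E s \<alpha>" "V.rec_fun f s" "Vset E \<alpha> = app E f \<alpha>"
    using is_V_Vset[OF \<alpha>] is_V_iff_rec_fun by blast
  have f: "is_function E f s" using fs(2) unfolding V.rec_fun_def by blast
  have f_step: "E x (app E f \<beta>) \<longleftrightarrow> (\<exists>\<gamma>. E \<gamma> \<beta> \<and> subset E x (app E f \<gamma>))" if "E \<beta> s" for \<beta> x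
    using fs(2) that unfolding V.rec_fun_def V_step_def by blast
  define t where "t = (\<lambda>_::nat. f)"
  define p where "p = fBall 4 0 (fInApp 4 1 0 30)"
  have "\<forall>\<delta>. E \<delta> \<alpha> \<longrightarrow> E \<delta> (app E f \<alpha>)"
  proof (rule definable_eps_induct[where S=s and p=p and t=t
        and Q="\<lambda>\<beta>. \<forall>\<delta>. E \<delta> \<beta> \<longrightarrow> E \<delta> (app E f \<beta>)"])
    show "transitive E s" using transitive_succ fs(1) \<alpha> unfolding Ord_def by blast
    show "fm_jfree p" by (simp add: p_def)
    show "E \<alpha> s" using succ_mem fs(1) by blast
  next
    fix x assume "E x s"
    then show "sat E id (t(0:=x)) p \<longleftrightarrow> (\<forall>\<delta>. E \<delta> x \<longrightarrow> E \<delta> (app E f x))"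
      using in_app_iff function_defined_at[OF f] by (simp add: p_def t_def)
  next
    fix x assume x: "E x s" and IH: "\<And>y. E y x \<Longrightarrow> \<forall>\<delta>. E \<delta> y \<longrightarrow> E \<delta> (app E f y)"
    have "subset E \<delta> (app E f \<delta>)" if "E \<delta> x" for \<delta>
      using IH that unfolding subset_def by blast
    then show "\<forall>\<delta>. E \<delta> x \<longrightarrow> E \<delta> (app E f x)" using f_step[OF x] by blast
  qed
  then show ?thesis using \<delta> fs(3) by simp
qed

lemma oadd_rec_fun:
  assumes "Ord E a" "Ord E b"
  obtains s f where "is_succ E s b" "oadd E a b = app E f b"
    "\<And>\<beta> x. E \<beta> s \<Longrightarrow> E x (app E f \<beta>) \<longleftrightarrow> E x a \<or> (\<exists>\<gamma>. E \<gamma> \<beta> \<and> x = app E f \<gamma>)"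
proof -
  interpret A: zf_recursion E "oadd_step E a" a fOadd_step by (rule zf_recursion_oadd)
  obtain f s where "is_succ E s b" "A.rec_fun f s" "oadd E a b = app E f b"
    using is_oadd_oadd[OF assms] is_oadd_iff_rec_fun by blast
  then show ?thesis using that unfolding A.rec_fun_def oadd_step_def by blast
qed

lemma Ord_oadd:
  assumes a: "Ord E a" and b: "Ord E b"
  shows "Ord E (oadd E a b)"
proof -
  obtain s f where s: "is_succ E s b" and ab: "oadd E a b = app E f b"
    and f_step: "\<And>\<beta> x. E \<beta> s \<Longrightarrow> E x (app E f \<beta>) \<longleftrightarrow> E x a \<or> (\<exists>\<gamma>. E \<gamma> \<beta> \<and> x = app E f \<gamma>)"
    by (rule oadd_rec_fun[OF a b]) (rule that)
  have "Ord E s" using Ord_succ s b by blast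
  then have s_mem: "E \<gamma> s" and s_trans: "transitive E \<beta>" if "E \<beta> s" "E \<gamma> \<beta>" for \<beta> \<gamma>
    using that unfolding Ord_def transitive_def subset_def by blast+
  have mono: "subset E (app E f \<gamma>) (app E f \<beta>)" if \<beta>: "E \<beta> s" and \<gamma>: "E \<gamma> \<beta>" for \<beta> \<gamma>
    unfolding subset_def
  proof (intro allI impI)
    fix z assume "E z (app E f \<gamma>)"
    then consider "E z a" | \<delta> where "E \<delta> \<gamma>" "z = app E f \<delta>"
      using f_step[OF s_mem[OF \<beta> \<gamma>]] by blast
    then show "E z (app E f \<beta>)"
    proof cases
      case 1
      then show ?thesis using f_step[OF \<beta>] by blast
    next
      case 2
      then have "E \<delta> \<beta>" using s_trans[OF \<beta> \<gamma>] \<gamma> unfolding transitive_def subset_def by blast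
      then show ?thesis using f_step[OF \<beta>] 2 by blast
    qed
  qed
  have trans: "transitive E (app E f \<beta>)" if \<beta>: "E \<beta> s" for \<beta>
    unfolding transitive_def
  proof (intro allI impI)
    fix y assume "E y (app E f \<beta>)"
    then consider "E y a" | \<gamma> where "E \<gamma> \<beta>" "y = app E f \<gamma>" using f_step[OF \<beta>] by blast
    then show "subset E y (app E f \<beta>)"
    proof cases
      case 1
      then show ?thesis using a f_step[OF \<beta>] unfolding Ord_def transitive_def subset_def by blast
    qed (use mono[OF \<beta>] in simp)
  qed
  have "E b s" using succ_mem s by blast
  moreover have "transitive E x" if "E x (app E f b)" for x
  proof -
    from that consider "E x a" | \<gamma> where "E \<gamma> b" "x = app E f \<gamma>" using f_step[OF \<open>E b s\<close>] by blast
    then show ?thesis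
    proof cases
      case 1
      then show ?thesis using a unfolding Ord_def by blast
    next
      case 2
      then show ?thesis using trans s unfolding is_succ_def by blast
    qed
  qed
  ultimately show ?thesis using trans ab unfolding Ord_def by simp
qed

lemma mem_oadd:
  assumes a: "Ord E a" and b: "Ord E b" and "E x b"
  shows "E a (oadd E a b)"
proof -
  obtain s f where s: "is_succ E s b" and ab: "oadd E a b = app E f b"
    and f_step: "\<And>\<beta> x. E \<beta> s \<Longrightarrow> E x (app E f \<beta>) \<longleftrightarrow> E x a \<or> (\<exists>\<gamma>. E \<gamma> \<beta> \<and> x = app E f \<gamma>)"
    by (rule oadd_rec_fun[OF a b]) (rule that)
  obtain m where m: "E m b" "\<forall>z. E z m \<longrightarrow> \<not> E z b" using foundation \<open>E x b\<close> by blast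
  have m_empty: "\<not> E z m" for z
    using b m unfolding Ord_def transitive_def subset_def by blast
  have "E m s" "E b s" using m(1) s unfolding is_succ_def by blast+
  have "E z (app E f m) \<longleftrightarrow> E z a" for z
    using f_step[OF \<open>E m s\<close>, of z] m_empty by blast
  then have "app E f m = a" by (rule extensionality)
  then show ?thesis using f_step[OF \<open>E b s\<close>, of a] m(1) ab by auto
qed

end

lemma evalt_jfree: "trm_jfree u \<Longrightarrow> evalt j s u = evalt j' s u"
  by (cases u) auto

lemma satD_jfree: "fm_jfree p \<Longrightarrow> satD E j D s p = satD E j' D s p"
proof (induction p arbitrary: s)
  case (Mem a b)
  then show ?case using evalt_jfree[of a j s j'] evalt_jfree[of b j s j'] by simp
next
  case (Eq a b)
  then show ?case using evalt_jfree[of a j s j'] evalt_jfree[of b j s j'] by simp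
qed auto

fun trm_var :: "trm \<Rightarrow> nat" where
  "trm_var (Var n) = n"
| "trm_var (J u) = trm_var u"

fun max_var :: "fm \<Rightarrow> nat" where
  "max_var (Mem a b) = max (trm_var a) (trm_var b)"
| "max_var (Eq a b) = max (trm_var a) (trm_var b)"
| "max_var (Neg p) = max_var p"
| "max_var (Conj p q) = max (max_var p) (max_var q)"
| "max_var (Ex x p) = max x (max_var p)"

lemma evalt_cong: "(\<And>i. i \<le> trm_var u \<Longrightarrow> s i = s' i) \<Longrightarrow> evalt j s u = evalt j s' u"
  by (induction u) auto

lemma satD_cong: "(\<And>i. i \<le> max_var p \<Longrightarrow> s i = s' i) \<Longrightarrow> satD E j D s p = satD E j D s' p"
proof (induction p arbitrary: s s')
  case (Mem a b)
  have "evalt j s a = evalt j s' a" "evalt j s b = evalt j s' b"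
    using Mem.prems by (auto intro: evalt_cong)
  then show ?case by simp
next
  case (Eq a b)
  have "evalt j s a = evalt j s' a" "evalt j s b = evalt j s' b"
    using Eq.prems by (auto intro: evalt_cong)
  then show ?case by simp
next
  case (Neg p)
  have "satD E j D s p = satD E j D s' p" by (rule Neg.IH, rule Neg.prems) simp
  then show ?case by simp
next
  case (Conj p q)
  have "satD E j D s p = satD E j D s' p" by (rule Conj.IH(1), rule Conj.prems) simp
  moreover have "satD E j D s q = satD E j D s' q" by (rule Conj.IH(2), rule Conj.prems) simp
  ultimately show ?case by simp
next
  case (Ex x p)
  have "satD E j D (s(x:=a)) p = satD E j D (s'(x:=a)) p" for a
  proof (rule Ex.IH)
    fix i assume "i \<le> max_var p"
    then show "(s(x:=a)) i = (s'(x:=a)) i" using Ex.prems[of i] by simp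
  qed
  then show ?case by simp
qed

fun relativize :: "nat \<Rightarrow> fm \<Rightarrow> fm" where
  "relativize a (Mem u v) = Mem u v"
| "relativize a (Eq u v) = Eq u v"
| "relativize a (Neg p) = Neg (relativize a p)"
| "relativize a (Conj p q) = Conj (relativize a p) (relativize a q)"
| "relativize a (Ex x p) = Ex x (Conj (Mem (Var x) (Var a)) (relativize a p))"

lemma fm_jfree_relativize: "fm_jfree (relativize a p) = fm_jfree p"
  by (induction p) auto

lemma sat_relativize: "max_var p < a \<Longrightarrow> sat E j t (relativize a p) = satD E j (\<lambda>x. E x (t a)) t p"
proof (induction p arbitrary: t)
  case (Ex x p)
  then have "x \<noteq> a" "max_var p < a" by simp_all
  have "sat E j (t(x:=b)) (relativize a p) = satD E j (\<lambda>y. E y (t a)) (t(x:=b)) p" for b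
  proof -
    have "(t(x:=b)) a = t a" using \<open>x \<noteq> a\<close> by simp
    moreover have "sat E j (t(x:=b)) (relativize a p) = satD E j (\<lambda>y. E y ((t(x:=b)) a)) (t(x:=b)) p"
      using \<open>max_var p < a\<close> by (rule Ex.IH)
    ultimately show ?thesis by (simp only:)
  qed
  with \<open>x \<noteq> a\<close> show ?case by (simp add: sat_def)
qed (auto simp: sat_def)

fun Jpow :: "nat \<Rightarrow> trm \<Rightarrow> trm" where
  "Jpow 0 u = u"
| "Jpow (Suc n) u = J (Jpow n u)"

lemma evalt_Jpow[simp]: "evalt j s (Jpow n u) = (j^^n) (evalt j s u)"
  by (induction n) auto

lemma trm_var_Jpow[simp]: "trm_var (Jpow n u) = trm_var u"
  by (induction n) auto

definition "dUpair z x y v = Conj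
   (Neg (Ex v (Conj (Mem (Var v) (Var z)) (Conj (Neg (Eq (Var v) x)) (Neg (Eq (Var v) y))))))
   (Conj (Mem x (Var z)) (Mem y (Var z)))"

lemma delta0_dUpair: "v \<noteq> z \<Longrightarrow> delta0 (dUpair z x y v)"
  by (simp add: dUpair_def)

lemma sat_dUpair:
  assumes "z < v" "trm_var x < v" "trm_var y < v"
  shows "sat E j s (dUpair z x y v) \<longleftrightarrow> upair E (s z) (evalt j s x) (evalt j s y)"
proof -
  have "evalt j (s(v:=a)) x = evalt j s x" "evalt j (s(v:=a)) y = evalt j s y" for a
    using assms by (auto intro: evalt_cong)
  with assms have "sat E j s (dUpair z x y v) \<longleftrightarrow> (\<forall>a. E a (s z) \<longrightarrow> a = evalt j s x \<or> a = evalt j s y) \<and>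
      E (evalt j s x) (s z) \<and> E (evalt j s y) (s z)"
    by (auto simp: dUpair_def)
  then show ?thesis unfolding upair_def by blast
qed

text \<open>The unordered pairs making up the Kuratowski pair are bounded by the pair itself
(variable 0), which keeps the formula Delta_0.\<close>
definition "fGraphIterate n = Ex 2 (Conj (Mem (Var 2) (Var 1)) (Ex 3 (Conj (Mem (Var 3) (Var 0))
   (Ex 4 (Conj (Mem (Var 4) (Var 0)) (Conj (dUpair 3 (Var 2) (Var 2) 5)
     (Conj (dUpair 4 (Var 2) (Jpow n (Var 2)) 5) (dUpair 0 (Var 3) (Var 4) 5))))))))"

lemma delta0_fGraphIterate: "delta0 (fGraphIterate n)"
  by (simp add: fGraphIterate_def delta0_dUpair)

lemma sat_fGraphIterate:
  "sat E j (t(0:=z)) (fGraphIterate n) \<longleftrightarrow> (\<exists>x. E x (t 1) \<and> kpair E z x ((j^^n) x))"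
proof -
  have "sat E j (t(0:=z)) (fGraphIterate n) \<longleftrightarrow> (\<exists>x. E x (t 1) \<and> (\<exists>u. E u z \<and> (\<exists>w. E w z \<and>
      upair E u x x \<and> upair E w x ((j^^n) x) \<and> upair E z u w)))"
    by (simp add: fGraphIterate_def sat_dUpair)
  also have "\<dots> \<longleftrightarrow> (\<exists>x. E x (t 1) \<and> kpair E z x ((j^^n) x))"
    unfolding kpair_def upair_def by blast
  finally show ?thesis .
qed

context zf
begin

lemma kpair_mem_power_power:
  assumes P: "\<forall>z. E z P \<longleftrightarrow> subset E z U" and C: "\<forall>z. E z C \<longleftrightarrow> subset E z P"
    and "E x U" "E y U" "kpair E p x y"
  shows "E p C"
proof -
  obtain u w where uw: "upair E u x x" "upair E w x y" "upair E p u w"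
    using assms(5) unfolding kpair_def by blast
  have "E u P" using P uw(1) assms(3) unfolding upair_def subset_def by auto
  moreover have "E w P" using P uw(2) assms(3,4) unfolding upair_def subset_def by auto
  ultimately show ?thesis using C uw(3) unfolding upair_def subset_def by auto
qed

end

locale wa0 = zf E for E :: "'a \<Rightarrow> 'a \<Rightarrow> bool" +
  fixes j :: "'a \<Rightarrow> 'a"
  assumes WA0: "WA0 E j"
begin

lemma elementary: "fm_jfree p \<Longrightarrow> sat E j s p \<longleftrightarrow> sat E j (j \<circ> s) p"
  using WA0 unfolding WA0_def by blast

lemma delta0_separation: "delta0 p \<Longrightarrow> \<exists>b. \<forall>x. E x b \<longleftrightarrow> E x a \<and> sat E j (s(0:=x)) p"
  using WA0 unfolding WA0_def by blast

lemma elementary_iterate: "fm_jfree p \<Longrightarrow> sat E j s p \<longleftrightarrow> sat E j ((j^^n) \<circ> s) p"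
proof (induction n)
  case (Suc n)
  then have "sat E j s p \<longleftrightarrow> sat E j (j \<circ> ((j^^n) \<circ> s)) p" using elementary by blast
  also have "j \<circ> ((j^^n) \<circ> s) = (j^^Suc n) \<circ> s" by auto
  finally show ?case .
qed simp

lemma iterate_mem: "E x y \<Longrightarrow> E ((j^^n) x) ((j^^n) y)"
  using elementary_iterate[where p="fMem 0 1" and n=n and s="(\<lambda>_. x)(1:=y)"] by simp

lemma iterate_Ord: "Ord E x \<Longrightarrow> Ord E ((j^^n) x)"
  using elementary_iterate[where p="fOrd 0 30" and n=n and s="\<lambda>_. x"] by simp

definition "fIsV = Conj (fOrd 0 30) (zf_recursion.fRecValue fV_step 0 1)"

lemma fm_jfree_fIsV: "fm_jfree fIsV"
  using zf_recursion.fm_jfree_rec[OF zf_recursion_V] unfolding fIsV_def by simp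

lemma sat_fIsV: "sat E j t fIsV \<longleftrightarrow> is_V E (t 0) (t 1)"
proof -
  interpret V: zf_recursion E "V_step E" "t 20" fV_step by (rule zf_recursion_V)
  have "sat E j t fIsV \<longleftrightarrow> sat E id t fIsV"
    using satD_jfree[OF fm_jfree_fIsV] by (simp add: sat_def)
  also have "\<dots> \<longleftrightarrow> Ord E (t 0) \<and> sat E id t (V.fRecValue 0 1)" by (simp add: fIsV_def)
  also have "\<dots> \<longleftrightarrow> is_V E (t 0) (t 1)"
  proof (cases "Ord E (t 0)")
    case True
    then have "transitive E (t 0)" unfolding Ord_def by blast
    then show ?thesis using V.sat_fRecValue[of 0 1 t] True is_V_iff_rec_fun by simp
  qed (simp add: is_V_iff_rec_fun)
  finally show ?thesis .
qed

lemma iterate_is_V: "is_V E x v \<Longrightarrow> is_V E ((j^^n) x) ((j^^n) v)"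
  using elementary_iterate[OF fm_jfree_fIsV, of "(\<lambda>_. x)(1:=v)" n] by (simp add: sat_fIsV)

lemma iterate_restriction_exists:
  "\<exists>k. is_function E k A \<and> (\<forall>x. E x A \<longrightarrow> app E k x = (j^^n) x)"
proof -
  obtain U where U: "\<forall>z. E z U \<longleftrightarrow> E z A \<or> E z ((j^^n) A)" using binary_union by blast
  obtain P where P: "\<forall>z. E z P \<longleftrightarrow> subset E z U" using power by blast
  obtain C where C: "\<forall>z. E z C \<longleftrightarrow> subset E z P" using power by blast
  have graph_C: "E z C" if "E x A" "kpair E z x ((j^^n) x)" for x z
    using kpair_mem_power_power[OF P C] U iterate_mem that by blast
  define t where "t = (\<lambda>_::nat. A)"
  obtain k where "\<forall>z. E z k \<longleftrightarrow> E z C \<and> sat E j (t(0:=z)) (fGraphIterate n)"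
    using delta0_separation[OF delta0_fGraphIterate] by blast
  then have k: "E z k \<longleftrightarrow> (\<exists>x. E x A \<and> kpair E z x ((j^^n) x))" for z
    using sat_fGraphIterate[where t=t and z=z and n=n] graph_C unfolding t_def by auto
  have k_val: "(\<exists>p. E p k \<and> kpair E p x y) \<longleftrightarrow> y = (j^^n) x" if x: "E x A" for x y
  proof
    assume "\<exists>p. E p k \<and> kpair E p x y"
    then obtain p x' where "kpair E p x y" "kpair E p x' ((j^^n) x')" using k by blast
    then show "y = (j^^n) x" using kpair_inject by metis
  next
    assume "y = (j^^n) x"
    moreover obtain p where "kpair E p x ((j^^n) x)" using kpair_ex by blast
    ultimately show "\<exists>p. E p k \<and> kpair E p x y" using k x by blast
  qed
  have "is_function E k A"
    unfolding is_function_def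
  proof (intro conjI allI impI)
    fix p assume "E p k"
    then show "\<exists>x y. kpair E p x y \<and> E x A" using k by blast
  next
    fix x assume "E x A"
    then show "\<exists>!y. \<exists>p. E p k \<and> kpair E p x y" by (simp add: k_val)
  qed
  moreover have "app E k x = (j^^n) x" if "E x A" for x
    using k_val[OF that] app_eq function_defined_at[OF \<open>is_function E k A\<close> that] by blast
  ultimately show ?thesis by blast
qed

lemma elem_emb_iterate:
  assumes k: "is_function E k A" "\<forall>x. E x A \<longrightarrow> app E k x = (j^^n) x"
  shows "elem_emb E k A ((j^^n) A)"
  unfolding elem_emb_def fun_into_def
proof (intro conjI allI impI k(1))
  fix x assume "E x A" then show "E (app E k x) ((j^^n) A)" using k(2) iterate_mem by simp
next
  fix p and s :: "nat \<Rightarrow> 'a" assume p: "fm_jfree p" and s: "\<forall>i. E (s i) A"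
  define a where "a = Suc (max_var p)"
  define t where "t = s(a:=A)"
  have a: "max_var p < a" unfolding a_def by simp
  have t: "t i = s i" if "i \<le> max_var p" for i using that a unfolding t_def by auto
  have "satD E id (\<lambda>x. E x A) s p \<longleftrightarrow> satD E j (\<lambda>x. E x A) s p" by (rule satD_jfree[OF p])
  also have "\<dots> \<longleftrightarrow> satD E j (\<lambda>x. E x (t a)) t p" using satD_cong[of p t s] t by (simp add: t_def)
  also have "\<dots> \<longleftrightarrow> sat E j t (relativize a p)" by (rule sat_relativize[OF a, symmetric])
  also have "\<dots> \<longleftrightarrow> sat E j ((j^^n) \<circ> t) (relativize a p)"
    using elementary_iterate fm_jfree_relativize p by blast
  also have "\<dots> \<longleftrightarrow> satD E j (\<lambda>x. E x (((j^^n) \<circ> t) a)) ((j^^n) \<circ> t) p"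
    by (rule sat_relativize[OF a])
  also have "\<dots> \<longleftrightarrow> satD E j (\<lambda>x. E x ((j^^n) A)) (\<lambda>i. (j^^n) (s i)) p"
    using satD_cong[of p "(j^^n) \<circ> t" "\<lambda>i. (j^^n) (s i)"] t by (simp add: t_def)
  also have "\<dots> \<longleftrightarrow> satD E id (\<lambda>x. E x ((j^^n) A)) (\<lambda>i. app E k (s i)) p"
    using satD_jfree[OF p] k(2) s by simp
  finally show "satD E id (\<lambda>x. E x A) s p \<longleftrightarrow> satD E id (\<lambda>x. E x ((j^^n) A)) (\<lambda>i. app E k (s i)) p" .
qed

end

context wa0
begin

lemma Vset_iterate: "Ord E \<beta> \<Longrightarrow> Vset E ((j^^n) \<beta>) = (j^^n) (Vset E \<beta>)"
  using Vset_eqI iterate_is_V is_V_Vset by blast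

lemma iterate_below_crit: "is_crit E j \<kappa> \<Longrightarrow> E \<gamma> \<kappa> \<Longrightarrow> (j^^n) \<gamma> = \<gamma>"
  unfolding is_crit_def by (induction n) auto

lemma crit_sequence_above:
  assumes \<kappa>: "is_crit E j \<kappa>" and cofinal: "\<forall>\<alpha>. Ord E \<alpha> \<longrightarrow> (\<exists>n. E \<alpha> ((j^^n) \<kappa>))"
    and \<eta>: "Ord E \<eta>"
  shows "\<exists>n. E \<eta> ((j^^n) \<kappa>) \<and> (j^^n) \<kappa> \<noteq> \<kappa>"
proof -
  obtain n where n: "E \<eta> ((j^^n) \<kappa>)" using cofinal \<eta> by blast
  show ?thesis
  proof (cases "(j^^n) \<kappa> = \<kappa>")
    case True
    obtain m where m: "E \<kappa> ((j^^m) \<kappa>)" using cofinal \<kappa> unfolding is_crit_def by blast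
    have "Ord E ((j^^m) \<kappa>)" using iterate_Ord \<kappa> unfolding is_crit_def by blast
    then have "E \<eta> ((j^^m) \<kappa>)" using m n True unfolding Ord_def transitive_def subset_def by metis
    moreover have "(j^^m) \<kappa> \<noteq> \<kappa>" using m mem_irrefl by metis
    ultimately show ?thesis by blast
  qed (use n in blast)
qed

end

theorem mainTheorem18:
  fixes E :: "'a \<Rightarrow> 'a \<Rightarrow> bool" and j :: "'a \<Rightarrow> 'a" and \<kappa> :: 'a
  assumes "ZF E" and "WA0 E j" and "is_crit E j \<kappa>"
    and "\<forall>\<alpha>. Ord E \<alpha> \<longrightarrow> (\<exists>n. E \<alpha> ((j ^^ n) \<kappa>))"
  shows "extendible E \<kappa>"
  unfolding extendible_def
proof (intro allI impI, elim conjE exE)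
  interpret wa0 E j by (intro wa0.intro zf.intro wa0_axioms.intro assms(1,2))
  fix \<eta> x assume \<eta>: "Ord E \<eta>" and "E x \<eta>"
  have \<kappa>: "Ord E \<kappa>" using assms(3) unfolding is_crit_def by blast
  obtain n where n: "E \<eta> ((j^^n) \<kappa>)" "(j^^n) \<kappa> \<noteq> \<kappa>"
    using crit_sequence_above assms(3,4) \<eta> by blast
  define \<beta> where "\<beta> = oadd E \<kappa> \<eta>"
  have \<beta>: "Ord E \<beta>" "E \<kappa> \<beta>" using Ord_oadd mem_oadd \<kappa> \<eta> \<open>E x \<eta>\<close> unfolding \<beta>_def by blast+
  then have V\<beta>: "E \<gamma> (Vset E \<beta>)" if "E \<gamma> \<kappa> \<or> \<gamma> = \<kappa>" for \<gamma>
    using that mem_Vset unfolding Ord_def transitive_def subset_def by blast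
  obtain k where k: "is_function E k (Vset E \<beta>)" "\<forall>x. E x (Vset E \<beta>) \<longrightarrow> app E k x = (j^^n) x"
    using iterate_restriction_exists by blast
  have "elem_emb E k (Vset E \<beta>) (Vset E ((j^^n) \<beta>))"
    using elem_emb_iterate[OF k] Vset_iterate[OF \<beta>(1)] by simp
  moreover have "crit_emb E k \<kappa>"
    unfolding crit_emb_def using \<kappa> k(2) V\<beta> n(2) iterate_below_crit[OF assms(3)] by auto
  moreover have "E \<eta> (app E k \<kappa>)" using k(2) V\<beta> n(1) by simp
  ultimately show "\<exists>k \<theta>. Ord E \<theta> \<and> elem_emb E k (Vset E (oadd E \<kappa> \<eta>)) (Vset E \<theta>) \<and>
      crit_emb E k \<kappa> \<and> E \<eta> (app E k \<kappa>)"
    using iterate_Ord[OF \<beta>(1)] unfolding \<beta>_def by blast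
qed

end
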